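(* Let $\gamma=\dfrac{18}{9-\sqrt2}$. For every non-increasing function $\psi:\mathbb{R}_+\to\mathbb{R}_+$ with $\psi(1)\leq(9\gamma)^{-1}$ there is a vector $\boldsymbol\alpha\in\mathbb{R}^2$ such that every best approximation $\mathbf m_k$ of the linear form $\langle\boldsymbol\alpha,\cdot\rangle$ satisfies \[ \psi(|\mathbf m_k|)-4\gamma\psi(|\mathbf m_k|)^2< \|\langle\boldsymbol\alpha,\mathbf m_k\rangle\|\cdot|\mathbf m_k|^2\leq \psi(|\mathbf m_k|)+\gamma\psi(|\mathbf m_k|)^2. \] Moreover, the set of such $\boldsymbol\alpha$ has the cardinality of the continuum.
   Context: $|\mathbf x|$ is the Euclidean norm on $\mathbb{R}^2$, $\langle\cdot,\cdot\rangle$ the standard inner product, and $\|t\|$ the distance from $t\in\mathbb{R}$ to the nearest integer. A point $\mathbf m\in\mathbb{Z}^2\setminus\{\mathbf 0\}$ is a best approximation for $\langle\boldsymbol\alpha,\cdot\rangle$ if $\|\langle\boldsymbol\alpha,\mathbf m\rangle\|<\|\langle\boldsymbol\alpha,\mathbf m'\rangle\|$ for every $\mathbf m'\in\mathbb{Z}^2\setminus\{\mathbf 0\}$ with $|\mathbf m'|<|\mathbf m|$, and $\|\langle\boldsymbol\alpha,\mathbf m\rangle\|\leq\|\langle\boldsymbol\alpha,\mathbf m'\rangle\|$ for every $\mathbf m'\in\mathbb{Z}^2\setminus\{\pm\mathbf m\}$ with $|\mathbf m'|=|\mathbf m|$. The best approximations, ordered by Euclidean norm, form a sequence of pairs $\pm\mathbf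 m_k$. *)

theory Defs
  imports "HOL-Analysis.Analysis" "HOL-Library.Equipollence"
begin

definition dist_to_int :: "real \<Rightarrow> real"
  where "dist_to_int t = infdist t \<int>"

lemma dist_to_int_eq_round: "dist_to_int t = \<bar>t - of_int (round t)\<bar>"
proof (rule antisym)
  show "dist_to_int t \<le> \<bar>t - of_int (round t)\<bar>"
    unfolding dist_to_int_def by (rule infdist_le2[of "of_int (round t)"]) (auto simp: dist_real_def)
  have ne: "(\<int> :: real set) \<noteq> {}"
    using Ints_0 by blast
  show "\<bar>t - of_int (round t)\<bar> \<le> dist_to_int t"
    unfolding dist_to_int_def infdist_notempty[OF ne]
    by (rule cINF_greatest[OF ne]) (auto simp: dist_real_def round_diff_minimal elim!: Ints_cases)
qed

definition int_lattice :: "(real ^ 2) set"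
  where "int_lattice = {m. \<forall>i. m $ i \<in> \<int>}"

definition best_approximation :: "real ^ 2 \<Rightarrow> real ^ 2 \<Rightarrow> bool"
  where "best_approximation \<alpha> m \<longleftrightarrow>
    m \<in> int_lattice - {0} \<and>
    (\<forall>m' \<in> int_lattice - {0}. norm m' < norm m \<longrightarrow>
       dist_to_int (\<alpha> \<bullet> m) < dist_to_int (\<alpha> \<bullet> m')) \<and>
    (\<forall>m' \<in> int_lattice - {m, - m}. norm m' = norm m \<longrightarrow>
       dist_to_int (\<alpha> \<bullet> m) \<le> dist_to_int (\<alpha> \<bullet> m'))"

end

theory Submission
  imports Defs
begin

text \<open>
  An integer vector \<open>(p, q, n)\<close> is viewed as the rational line \<open>p x + q y = n\<close>. We build a sequence
  \<open>z\<^sub>0, z\<^sub>1, \<dots>\<close> in which any three consecutive vectors form a basis of the lattice of integer vectors,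
  and let \<open>\<alpha>\<close> be the limit of the intersection points of the lines \<open>z\<^sub>k\<close> and \<open>z\<^sub>k\<^sub>+\<^sub>1\<close>. With \<open>m\<^sub>k\<close> the projection
  of \<open>z\<^sub>k\<close> and \<open>w\<^sub>k = \<psi>(|m\<^sub>k|)\<close>, the value of the form \<open>z\<^sub>k\<close> at \<open>\<alpha>\<close> is close to \<open>1 / |m\<^sub>k\<^sub>+\<^sub>1 \<and> m\<^sub>k\<^sub>+\<^sub>2|\<close>.
  Writing \<open>z\<^sub>k\<^sub>+\<^sub>3 = e z\<^sub>k + a z\<^sub>k\<^sub>+\<^sub>1 + b z\<^sub>k\<^sub>+\<^sub>2\<close>, the coefficient \<open>a\<close> fixes \<open>m\<^sub>k\<^sub>+\<^sub>2 \<and> m\<^sub>k\<^sub>+\<^sub>3\<close> up to an error of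
  \<open>|m\<^sub>k\<^sub>+\<^sub>1 \<and> m\<^sub>k\<^sub>+\<^sub>2|\<close>, so it can be put near \<open>|m\<^sub>k\<^sub>+\<^sub>1|\<^sup>2 / w\<^sub>k\<^sub>+\<^sub>1\<close>, and \<open>b\<close> then puts \<open>|m\<^sub>k\<^sub>+\<^sub>3|\<^sup>2\<close> between one third and
  seven tenths of \<open>|m\<^sub>k\<^sub>+\<^sub>2|\<^sup>2 / w\<^sub>k\<^sub>+\<^sub>2\<close>. This growth is slow enough for \<open>\<plusminus>m\<^sub>k\<close> to be exactly the best approximations,
  provided that consecutive \<open>m\<^sub>k\<close> form acute angles and the values at \<open>\<alpha>\<close> alternate in sign; the sign \<open>e = \<plusminus>1\<close> takes
  care of the latter. The orientation of \<open>m\<^sub>k\<^sub>+\<^sub>1, m\<^sub>k\<^sub>+\<^sub>2\<close> remains free at every step, and \<open>\<alpha>\<close> determines it,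
  which gives continuum many \<open>\<alpha>\<close>.
\<close>

section \<open>Integer vectors and the inductive step\<close>

type_synonym ivec = "int \<times> int \<times> int"

fun wedge :: "ivec \<Rightarrow> ivec \<Rightarrow> int"
  where "wedge (p, q, n) (p', q', n') = p * q' - q * p'"

fun scal :: "ivec \<Rightarrow> ivec \<Rightarrow> int"
  where "scal (p, q, n) (p', q', n') = p * p' + q * q'"

text \<open>The determinant; value 1 or -1 means that the three vectors form a basis of the integer
  lattice. \<open>wedge a b\<close> is \<open>vol a b (0, 0, 1)\<close>.\<close>

fun vol :: "ivec \<Rightarrow> ivec \<Rightarrow> ivec \<Rightarrow> int"
  where "vol (p, q, n) (p', q', n') (p'', q'', n'') =
    p * (q' * n'' - n' * q'') - q * (p' * n'' - n' * p'') + n * (p' * q'' - q' * p'')"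

fun lin :: "real \<Rightarrow> real \<Rightarrow> ivec \<Rightarrow> real"
  where "lin x y (p, q, n) = p * x + q * y - n"

text \<open>Ternary, to serve both for the recursion and for basis expansions; the multiple of
  \<open>v\<close> by \<open>k\<close> is written \<open>comb k v 0 v 0 v\<close>.\<close>

fun comb :: "int \<Rightarrow> ivec \<Rightarrow> int \<Rightarrow> ivec \<Rightarrow> int \<Rightarrow> ivec \<Rightarrow> ivec"
  where "comb e (p, q, n) a (p', q', n') b (p'', q'', n'') =
    (e * p + a * p' + b * p'', e * q + a * q' + b * q'', e * n + a * n' + b * n'')"

lemma scal_self_nonneg: "0 \<le> scal a a"
  by (cases a) simp

text \<open>Lagrange's identity: it splits the squared length of one vector into its parts across
  and along the other.\<close>

lemma wedge_scal_squares: "(wedge a b)\<^sup>2 + (scal a b)\<^sup>2 = scal a a * scal b b"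
  by (cases a; cases b) (simp add: algebra_simps power2_eq_square)

lemma vol_cyclic: "vol b c a = vol a b c"
  by (cases a; cases b; cases c) (simp add: algebra_simps)

lemma wedge_comb: "wedge c (comb e a s b t c) = e * wedge c a - s * wedge b c"
  by (cases a; cases b; cases c) (simp add: algebra_simps)

lemma scal_comb: "scal c (comb e a s b t c) = e * scal c a + s * scal c b + t * scal c c"
  by (cases a; cases b; cases c) (simp add: algebra_simps)

lemma vol_comb: "vol b c (comb e a s b t c) = e * vol a b c"
  by (cases a; cases b; cases c) (simp add: algebra_simps)

lemma lin_comb: "lin x y (comb e a s b t c) = e * lin x y a + s * lin x y b + t * lin x y c"
  by (cases a; cases b; cases c) (simp add: algebra_simps)

text \<open>A three-term Pluecker relation for \<open>a\<close>, \<open>c\<close>, \<open>z\<close>,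
  \<open>(0, 0, 1)\<close> with common vector \<open>b\<close>.\<close>

lemma vol_wedge_exchange: "vol a b z * wedge b c - vol b c z * wedge a b = vol a b c * wedge b z"
  by (cases a; cases b; cases c; cases z) (simp add: algebra_simps)

text \<open>Cramer's rule expands \<open>z\<close> in \<open>a\<close>, \<open>b\<close>,
  \<open>(0, 0, 1)\<close>, and the form \<open>(0, 0, 1)\<close> has value -1 everywhere.\<close>

lemma wedge_lin:
  "wedge a b * lin x y z = wedge z b * lin x y a + wedge a z * lin x y b - vol a b z"
  by (cases a; cases b; cases z) (simp add: algebra_simps)

lemma vol_cramer:
  "comb (vol z b c) a (vol a z c) b (vol a b z) c = comb (vol a b c) z 0 z 0 z"
  by (cases a; cases b; cases c; cases z) (simp add: algebra_simps)

text \<open>Cramer's rule has integer coefficients when the determinant is a unit.\<close>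

lemma comb_of_vol:
  assumes "\<bar>vol a b c\<bar> = 1"
  obtains s t u where "z = comb s a t b u c" and "u = 0 \<longleftrightarrow> vol a b z = 0"
proof
  let ?v = "vol a b c"
  have v: "?v * ?v = 1" using assms by (simp add: abs_if split: if_splits)
  have scale: "comb (k * s) a (k * t) b (k * u) c = comb k (comb s a t b u c) 0 z 0 z" for k s t u
    by (cases a; cases b; cases c; cases z) (simp add: algebra_simps)
  have "comb k (comb k z 0 z 0 z) 0 z 0 z = z" if "k * k = 1" for k
    using that by (cases z) (simp flip: mult.assoc)
  then show "z = comb (?v * vol z b c) a (?v * vol a z c) b (?v * vol a b z) c"
    using v unfolding scale vol_cramer by simp
  show "?v * vol a b z = 0 \<longleftrightarrow> vol a b z = 0" using v by auto
qed

text \<open>Made for a component \<open>r\<close> that is adjustable only by integers: the window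
  for the squared length contains a whole half-open unit interval of \<open>r\<close>.\<close>

lemma norm_window:
  fixes s Q :: real
  assumes "0 \<le> s" "s \<le> 49/4" "21 \<le> Q"
  obtains r0 where "0 \<le> r0" "\<And>r. r0 < r \<Longrightarrow> r \<le> r0 + 1 \<Longrightarrow> Q / 3 \<le> s + r\<^sup>2 \<and> s + r\<^sup>2 \<le> 7/10 * Q"
proof (cases "s \<le> Q / 3")
  case True
  define r0 where "r0 = sqrt (Q / 3 - s)"
  have r0: "0 \<le> r0" "r0\<^sup>2 = Q / 3 - s" using True by (auto simp: r0_def)
  have *: "Q / 3 \<le> s + r\<^sup>2 \<and> s + r\<^sup>2 \<le> 7/10 * Q" if r: "r0 < r" "r \<le> r0 + 1" for r
  proof
    have "r0\<^sup>2 \<le> r\<^sup>2" using r r0 by (intro power_mono) auto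
    then show "Q / 3 \<le> s + r\<^sup>2" using r0 by simp
    have "r\<^sup>2 \<le> (r0 + 1)\<^sup>2" using r r0 by (intro power_mono) auto
    then have "s + r\<^sup>2 \<le> Q / 3 + 2 * r0 + 1" using r0 by (simp add: power2_eq_square algebra_simps)
    \<comment> \<open>The goal \<open>2 * r0 + 1 \<le> (7/10 - 1/3) * Q\<close> is
      \<open>r0 \<le> Q * 11/60 - 1/2\<close>, and \<open>r0\<close> is at most the root of
      \<open>Q / 3\<close>.\<close>
    moreover have "(Q * 11/60 - 1/2)\<^sup>2 \<ge> Q / 3"
    proof -
      have "21 * Q \<le> Q * Q" using assms by (intro mult_right_mono) auto
      moreover have "(Q * 11/60 - 1/2)\<^sup>2 = 121/3600 * (Q * Q) - 11/60 * Q + 1/4"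
        by (simp add: power2_eq_square field_simps)
      ultimately show ?thesis using assms by linarith
    qed
    then have "r0\<^sup>2 \<le> (Q * 11/60 - 1/2)\<^sup>2" using r0 assms by linarith
    then have "r0 \<le> Q * 11/60 - 1/2" by (rule power2_le_imp_le) (use assms in auto)
    ultimately show "s + r\<^sup>2 \<le> 7/10 * Q" using r0 by linarith
  qed
  show ?thesis by (rule that[OF r0(1) *])
next
  case False
  \<comment> \<open>With \<open>r0 = 0\<close> the upper bound holds because 49/4 + 1 is below 7/10
    times 21.\<close>
  have *: "Q / 3 \<le> s + r\<^sup>2 \<and> s + r\<^sup>2 \<le> 7/10 * Q" if r: "0 < r" "r \<le> 0 + 1" for r
  proof -
    have "r\<^sup>2 \<le> 1" using r by (intro power_le_one) auto
    then show ?thesis using assms False zero_le_power2[of r] by linarith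
  qed
  show ?thesis by (rule that[OF order.refl *])
qed

text \<open>Here \<open>x\<close> and \<open>y\<close> are the weights of \<open>b\<close> and
  \<open>c\<close>. In \<open>d = comb e a u b v c\<close> the sign \<open>e\<close> fixes the
  determinant, \<open>u\<close> fixes the wedge with \<open>c\<close>, and \<open>v\<close> then
  changes only the component along \<open>c\<close>.\<close>

lemma chain_step:
  fixes a b c :: ivec and x y :: real and s :: int
  assumes vol: "\<bar>vol a b c\<bar> = 1" and W: "wedge b c \<noteq> 0"
    and Wle: "\<bar>wedge b c\<bar> \<le> 7/2 * real_of_int (scal b b)"
    and x: "0 < x" "x \<le> 1/21" and y: "0 < y" "y \<le> 1/21"
    and N: "scal b b / 3 \<le> x * scal c c" and s: "\<bar>s\<bar> = 1"
  obtains d where "vol b c d = - sgn (wedge b c) * s * vol a b c"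
    "scal b b / x \<le> s * wedge c d" "s * wedge c d \<le> scal b b / x + \<bar>wedge b c\<bar>"
    "s * wedge c d \<le> 7/2 * real_of_int (scal c c)"
    "0 < scal c d" "scal c c / 3 \<le> y * scal d d" "y * scal d d \<le> 7/10 * real_of_int (scal c c)"
proof -
  define e where "e = - sgn (wedge b c) * s"
  define D where "D = \<bar>wedge b c\<bar>"
  have D: "0 < D" using W by (simp add: D_def)
  define T where "T = scal b b / x"
  have bb: "0 < scal b b"
    using scal_self_nonneg[of b] wedge_scal_squares[of b c] W by (cases "scal b b = 0") auto
  have cc: "0 < scal c c"
    using scal_self_nonneg[of c] wedge_scal_squares[of b c] W by (cases "scal c c = 0") auto
  define k where "k = s * e * wedge c a"
  \<comment> \<open>The least multiple of \<open>D\<close> that lifts \<open>w\<close> to the target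
    \<open>T\<close>; the overshoot stays within \<open>D\<close>.\<close>
  define t where "t = \<lceil>(T - k) / D\<rceil>"
  define w where "w = k + t * D"
  have w1: "T \<le> w"
  proof -
    have "(T - k) / D \<le> t" unfolding t_def by linarith
    then show ?thesis using D by (simp add: w_def field_simps)
  qed
  have w2: "w \<le> T + D"
  proof -
    have "t \<le> (T - k) / D + 1" unfolding t_def by linarith
    then have "real_of_int t * real_of_int D \<le> ((T - k) / D + 1) * D" using D by (intro mult_right_mono) auto
    also have "\<dots> = T - k + D" using D by (simp add: distrib_right)
    finally show ?thesis by (simp add: w_def)
  qed
  \<comment> \<open>The overshoot is at most \<open>T / 6\<close> because
    \<open>x \<le> 1/21\<close>, and \<open>T\<close> is at most three times
    \<open>scal c c\<close>.\<close>
  have w3: "w \<le> 7/2 * real_of_int (scal c c)"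
  proof -
    have "7/2 * real_of_int (scal b b) \<le> T * (1/6)"
      using x bb by (simp add: T_def field_simps)
    moreover have "T / 3 \<le> scal c c"
      using N x by (simp add: T_def field_simps)
    ultimately show ?thesis using w2 Wle unfolding D_def by linarith
  qed
  have "0 \<le> T" using x bb by (simp add: T_def)
  then have w0: "0 \<le> w" using w1 by linarith
  define u where "u = - s * sgn (wedge b c) * t"
  have ss: "s * s = 1" using s by (simp add: abs_if split: if_splits)
  have wedge: "s * wedge c (comb e a u b v c) = w" for v
  proof -
    have "s * wedge c (comb e a u b v c) = k - s * u * wedge b c"
      by (simp add: wedge_comb k_def algebra_simps)
    also have "s * u * wedge b c = - (s * s) * t * (sgn (wedge b c) * wedge b c)"
      by (simp add: u_def)
    also have "sgn (wedge b c) * wedge b c = D" by (simp add: D_def sgn_mult_self_eq abs_sgn mult.commute)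
    finally show ?thesis using ss by (simp add: w_def)
  qed
  define C where "C = real_of_int (scal c c)"
  have C: "0 < C" using cc by (simp add: C_def)
  define q where "q = (w / C)\<^sup>2"
  have q: "0 \<le> q" "q \<le> 49/4"
  proof -
    have "w / C \<le> 7/2" using w3 C by (simp add: C_def field_simps)
    then have "q \<le> (7/2)\<^sup>2" unfolding q_def using w0 C by (intro power_mono) auto
    then show "q \<le> 49/4" by (simp add: power2_eq_square)
  qed (simp add: q_def)
  have "21 \<le> 1 / y" using y by (simp add: field_simps)
  then obtain r0 where r0: "0 \<le> r0"
    "\<And>r. r0 < r \<Longrightarrow> r \<le> r0 + 1 \<Longrightarrow> (1 / y) / 3 \<le> q + r\<^sup>2 \<and> q + r\<^sup>2 \<le> 7/10 * (1 / y)"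
    using norm_window[OF q] by blast
  define h where "h = e * scal c a + u * scal c b"
  \<comment> \<open>Raising \<open>v\<close> by 1 raises \<open>r = scal c d / C\<close> by 1, so a
    floor puts \<open>r\<close> into the interval above \<open>r0\<close>; positivity of
    \<open>r\<close> makes the angle acute.\<close>
  define v where "v = \<lfloor>r0 + 1 - h / C\<rfloor>"
  define d where "d = comb e a u b v c"
  define r where "r = h / C + v"
  have r: "r0 < r" "r \<le> r0 + 1" unfolding r_def v_def by linarith+
  have scd: "real_of_int (scal c d) = r * C"
    using C by (simp add: d_def scal_comb r_def h_def C_def field_simps)
  have wcd: "s * wedge c d = w" using wedge by (simp add: d_def)
  have "real_of_int ((wedge c d)\<^sup>2) = w\<^sup>2"
    using wcd ss by (metis mult_1 power2_eq_square power_mult_distrib)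
  then have "w\<^sup>2 + (r * C)\<^sup>2 = C * scal d d"
    using wedge_scal_squares[of c d] scd unfolding C_def by (metis of_int_add of_int_mult of_int_power)
  then have dd: "scal d d = C * (q + r\<^sup>2)"
    using C by (simp add: q_def field_simps power2_eq_square)
  have "1 / 3 \<le> y * (q + r\<^sup>2)" "y * (q + r\<^sup>2) \<le> 7/10"
    using r0(2)[OF r] y by (auto simp: field_simps)
  from this[THEN mult_left_mono, of C] have dd': "C / 3 \<le> y * scal d d" "y * scal d d \<le> 7/10 * C"
    using dd C by (auto simp: algebra_simps)
  have "0 < real_of_int (scal c d)" unfolding scd using r r0 C by simp
  then have sp: "0 < scal c d" by simp
  show ?thesis
    by (rule that[of d]) (use w1 w2 w3 dd' sp wcd in \<open>simp_all add: T_def D_def C_def e_def d_def vol_comb\<close>)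
qed

section \<open>The limit point of a chain\<close>

text \<open>The intervals around \<open>u j\<close> of radius \<open>10/9 * g j\<close> are nested;
  10/9 is the sum of the geometric series with ratio 1/10.\<close>

lemma nested_geometric_limit:
  fixes u g :: "nat \<Rightarrow> real"
  assumes u: "\<And>j. \<bar>u (Suc j) - u j\<bar> \<le> g j" and g: "\<And>j. g (Suc j) \<le> g j / 10"
  obtains L where "u \<longlonglongrightarrow> L" "\<And>k. \<bar>L - u k\<bar> \<le> 10/9 * g k"
proof -
  have g0: "0 \<le> g j" for j using u[of j] by linarith
  have gle: "g j \<le> g 0 * (1/10) ^ j" for j
  proof (induction j)
    case (Suc j) then show ?case using g[of j] by simp
  qed simp
  have "(\<lambda>j. g 0 * (1/10) ^ j) \<longlonglongrightarrow> g 0 * 0"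
    by (intro tendsto_mult tendsto_const LIMSEQ_power_zero) simp
  then have glim: "g \<longlonglongrightarrow> 0"
    using g0 gle by (intro tendsto_sandwich[of "\<lambda>_. 0" g sequentially "\<lambda>j. g 0 * (1/10) ^ j"]) auto
  define a where "a j = u j - 10/9 * g j" for j
  define b where "b j = u j + 10/9 * g j" for j
  have ab: "(\<lambda>j. a j - b j) \<longlonglongrightarrow> 0"
  proof -
    have "(\<lambda>j. - (20/9) * g j) \<longlonglongrightarrow> - (20/9) * 0" by (intro tendsto_mult tendsto_const glim)
    then show ?thesis by (simp add: a_def b_def)
  qed
  have "a j \<le> a (Suc j)" "b (Suc j) \<le> b j" "a j \<le> b j" for j
    using u[of j] g[of j] g0[of j] unfolding a_def b_def by linarith+
  then obtain L where L: "\<And>j. a j \<le> L" "a \<longlonglongrightarrow> L" "\<And>j. L \<le> b j"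
    using nested_sequence_unique[of a b] ab by auto
  have "(\<lambda>j. a j + 10/9 * g j) \<longlonglongrightarrow> L + 10/9 * 0"
    by (intro tendsto_add tendsto_mult tendsto_const L glim)
  then have "u \<longlonglongrightarrow> L" by (simp add: a_def)
  moreover have "\<bar>L - u k\<bar> \<le> 10/9 * g k" for k
    using L(1)[of k] L(3)[of k] unfolding a_def b_def by linarith
  ultimately show ?thesis by (rule that)
qed

section \<open>Lengths, chains and their growth\<close>

definition len :: "ivec \<Rightarrow> real"
  where "len v = sqrt (scal v v)"

lemma len_nonneg: "0 \<le> len v"
  by (simp add: len_def scal_self_nonneg)

lemma len_squared: "(len v)\<^sup>2 = scal v v"
  by (simp add: len_def scal_self_nonneg)

lemma abs_wedge_le: "\<bar>real_of_int (wedge a b)\<bar> \<le> len a * len b"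
proof (rule power2_le_imp_le)
  have "(wedge a b)\<^sup>2 \<le> scal a a * scal b b"
    using wedge_scal_squares[of a b] zero_le_power2[of "scal a b"] by linarith
  then have "real_of_int ((wedge a b)\<^sup>2) \<le> scal a a * scal b b" by (metis of_int_le_iff of_int_mult)
  then show "\<bar>real_of_int (wedge a b)\<bar>\<^sup>2 \<le> (len a * len b)\<^sup>2"
    by (simp add: power_mult_distrib len_squared)
qed (simp add: len_nonneg)

lemma abs_scal_le: "\<bar>real_of_int (scal a b)\<bar> \<le> len a * len b"
proof (rule power2_le_imp_le)
  have "(scal a b)\<^sup>2 \<le> scal a a * scal b b"
    using wedge_scal_squares[of a b] zero_le_power2[of "wedge a b"] by linarith
  then have "real_of_int ((scal a b)\<^sup>2) \<le> scal a a * scal b b" by (metis of_int_le_iff of_int_mult)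
  then show "\<bar>real_of_int (scal a b)\<bar>\<^sup>2 \<le> (len a * len b)\<^sup>2"
    by (simp add: power_mult_distrib len_squared)
qed (simp add: len_nonneg)

text \<open>\<open>w k\<close> abstracts the weight of \<open>z k\<close>. The start projects to a
  shortest nonzero lattice vector. Since the value of \<open>z k\<close> at the limit will be close
  to \<open>- V k / W (Suc k)\<close>, \<open>alternating\<close> says that consecutive values have
  opposite signs.\<close>

locale chain =
  fixes z :: "nat \<Rightarrow> ivec" and w :: "nat \<Rightarrow> real"
  assumes z_0: "z 0 = (1, 0, 0)"
    and vol_unit: "\<bar>vol (z k) (z (Suc k)) (z (Suc (Suc k)))\<bar> = 1"
    and alternating: "vol (z k) (z (Suc k)) (z (Suc (Suc k))) * vol (z (Suc k)) (z (Suc (Suc k))) (z (Suc (Suc (Suc k))))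
      * wedge (z (Suc k)) (z (Suc (Suc k))) * wedge (z (Suc (Suc k))) (z (Suc (Suc (Suc k)))) < 0"
    and wedge_0: "wedge (z 0) (z (Suc 0)) \<noteq> 0"
    and wedge_ge: "scal (z k) (z k) / w k \<le> \<bar>wedge (z (Suc k)) (z (Suc (Suc k)))\<bar>"
    and wedge_le: "\<bar>wedge (z (Suc k)) (z (Suc (Suc k)))\<bar> \<le> scal (z k) (z k) / w k + \<bar>wedge (z k) (z (Suc k))\<bar>"
    and wedge_bound: "\<bar>wedge (z k) (z (Suc k))\<bar> \<le> 7/2 * real_of_int (scal (z k) (z k))"
    and scal_pos: "0 < scal (z k) (z (Suc k))"
    and growth_ge: "scal (z k) (z k) / 3 \<le> w k * scal (z (Suc k)) (z (Suc k))"
    and growth_le: "w k * scal (z (Suc k)) (z (Suc k)) \<le> 7/10 * real_of_int (scal (z k) (z k))"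
    and w_pos: "0 < w k" and w_le: "w k \<le> 1/21" and w_dec: "w (Suc k) \<le> w k"
begin

definition N :: "nat \<Rightarrow> real" where "N k = scal (z k) (z k)"
definition W :: "nat \<Rightarrow> real" where "W k = wedge (z k) (z (Suc k))"
definition V :: "nat \<Rightarrow> real" where "V k = vol (z k) (z (Suc k)) (z (Suc (Suc k)))"
abbreviation X :: "nat \<Rightarrow> real" where "X k \<equiv> len (z k)"

lemma X_squared: "(X k)\<^sup>2 = N k" by (simp add: len_squared N_def)

lemma N_pos: "0 < N k"
proof (induction k)
  case 0 then show ?case by (simp add: N_def z_0)
next
  case (Suc k)
  then have "0 < w k * N (Suc k)" using growth_ge[of k] by (simp add: N_def)
  then show ?case using w_pos[of k] by (simp add: zero_less_mult_iff)
qed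

lemma X_pos: "0 < X k" using N_pos[of k] by (simp add: len_def N_def)

lemma wN_ge: "N k / 3 \<le> w k * N (Suc k)" and wN_le: "w k * N (Suc k) \<le> 7/10 * N k"
  using growth_ge[of k] growth_le[of k] by (auto simp: N_def)

lemma N_growth: "7 * N k \<le> N (Suc k)"
proof -
  have "w k * N (Suc k) \<le> 1/21 * N (Suc k)"
    using w_le[of k] N_pos[of "Suc k"] by (intro mult_right_mono) auto
  then show ?thesis using wN_ge[of k] by simp
qed

lemma X_growth: "2 * X k \<le> X (Suc k)"
proof (rule power2_le_imp_le)
  show "(2 * X k)\<^sup>2 \<le> (X (Suc k))\<^sup>2"
    using N_growth[of k] N_pos[of k] by (simp add: power_mult_distrib X_squared)
qed (simp add: len_nonneg)

lemma abs_V: "\<bar>V k\<bar> = 1"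
  using vol_unit[of k] unfolding V_def by linarith

lemma W_ge: "N k / w k \<le> \<bar>W (Suc k)\<bar>"
  using wedge_ge[of k] by (simp add: W_def N_def)

lemma W_bound: "\<bar>W k\<bar> \<le> 7/2 * N k"
  using wedge_bound[of k] by (simp add: W_def N_def)

lemma W_le: "\<bar>W (Suc k)\<bar> \<le> N k / w k + 7/2 * N k"
  using wedge_le[of k] wedge_bound[of k] by (simp add: W_def N_def)

lemma W_pos: "0 < \<bar>W k\<bar>"
proof (cases k)
  case 0 then show ?thesis using wedge_0 by (simp add: W_def)
next
  case (Suc j)
  have "0 < N j / w j" using N_pos w_pos by simp
  then show ?thesis using W_ge[of j] Suc by simp
qed

text \<open>Bounds, per unit length of a form, how much its value changes between consecutive
  rational points.\<close>

definition G :: "nat \<Rightarrow> real" where "G j = X (Suc j) / (\<bar>W j\<bar> * \<bar>W (Suc j)\<bar>)"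

lemma wX_le: "w k * X (Suc k) \<le> X k / 5"
proof (rule power2_le_imp_le)
  have "w k * (w k * N (Suc k)) \<le> 1/21 * (7/10 * N k)"
    by (rule mult_mono[OF w_le wN_le]) (use w_pos N_pos in \<open>auto simp: less_imp_le\<close>)
  also have "\<dots> \<le> N k / 25" using N_pos[of k] by simp
  finally show "(w k * X (Suc k))\<^sup>2 \<le> (X k / 5)\<^sup>2"
    by (simp add: power_mult_distrib power_divide X_squared) (simp add: power2_eq_square mult.assoc)
qed (simp add: len_nonneg)

text \<open>The ratio is \<open>X (j+2) * \<bar>W j\<bar>\<close> over
  \<open>X (j+1) * \<bar>W (j+2)\<bar>\<close>. The wedges contribute at most half of
  \<open>w (j+1)\<close>, and by \<open>wX_le\<close> the lengths contribute at most 1/5 of its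
  reciprocal.\<close>

lemma G_step: "G (Suc j) \<le> G j / 10"
proof -
  let ?w = "w (Suc j)"
  have "\<bar>W j\<bar> \<le> N (Suc j) / 2" using W_bound[of j] N_growth[of j] by linarith
  also have "\<dots> \<le> ?w * \<bar>W (Suc (Suc j))\<bar> / 2"
    using W_ge[of "Suc j"] w_pos[of "Suc j"] by (simp add: field_simps)
  finally have "X (Suc (Suc j)) * \<bar>W j\<bar> \<le> X (Suc (Suc j)) * (?w * \<bar>W (Suc (Suc j))\<bar> / 2)"
    using X_pos[of "Suc (Suc j)"] by (intro mult_left_mono) auto
  also have "\<dots> = (?w * X (Suc (Suc j))) * (\<bar>W (Suc (Suc j))\<bar> / 2)" by simp
  also have "\<dots> \<le> (X (Suc j) / 5) * (\<bar>W (Suc (Suc j))\<bar> / 2)"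
    using wX_le[of "Suc j"] by (intro mult_right_mono) auto
  finally have "X (Suc (Suc j)) * \<bar>W j\<bar> * 10 \<le> X (Suc j) * \<bar>W (Suc (Suc j))\<bar>" by simp
  then show ?thesis
    using W_pos[of j] W_pos[of "Suc j"] W_pos[of "Suc (Suc j)"] unfolding G_def
    by (simp add: divide_simps mult_ac)
qed

text \<open>Coordinates of the intersection point of the lines \<open>z j\<close> and
  \<open>z (Suc j)\<close>, by Cramer's rule.\<close>

definition px :: "nat \<Rightarrow> real" where "px j = - vol (z j) (z (Suc j)) (1, 0, 0) / W j"
definition py :: "nat \<Rightarrow> real" where "py j = - vol (z j) (z (Suc j)) (0, 1, 0) / W j"

lemma lin_p: "lin (px j) (py j) v = - vol (z j) (z (Suc j)) v / W j"
proof -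
  obtain p q n where v: "v = (p, q, n)" by (cases v)
  have "vol (z j) (z (Suc j)) v = p * vol (z j) (z (Suc j)) (1, 0, 0) + q * vol (z j) (z (Suc j)) (0, 1, 0)
      + n * wedge (z j) (z (Suc j))"
    unfolding v by (cases "z j"; cases "z (Suc j)") (simp add: algebra_simps)
  then have "real_of_int (vol (z j) (z (Suc j)) v) = p * vol (z j) (z (Suc j)) (1, 0, 0)
      + q * vol (z j) (z (Suc j)) (0, 1, 0) + n * W j"
    by (simp add: W_def)
  then show ?thesis
    using W_pos[of j] unfolding px_def py_def by (simp add: v field_simps)
qed

lemma lin_p_diff: "\<bar>lin (px (Suc j)) (py (Suc j)) v - lin (px j) (py j) v\<bar> \<le> G j * len v"
proof -
  let ?a = "z j" and ?b = "z (Suc j)" and ?c = "z (Suc (Suc j))"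
  have nz: "W j \<noteq> 0" "W (Suc j) \<noteq> 0" using W_pos[of j] W_pos[of "Suc j"] by auto
  have "real_of_int (vol ?a ?b v) * W (Suc j) - vol ?b ?c v * W j = V j * wedge ?b v"
    using arg_cong[OF vol_wedge_exchange[of ?a ?b v ?c], of real_of_int] by (simp add: W_def V_def)
  then have "lin (px (Suc j)) (py (Suc j)) v - lin (px j) (py j) v = V j * wedge ?b v / (W j * W (Suc j))"
    using nz unfolding lin_p by (simp add: field_simps)
  then have "\<bar>lin (px (Suc j)) (py (Suc j)) v - lin (px j) (py j) v\<bar> = \<bar>wedge ?b v\<bar> / (\<bar>W j\<bar> * \<bar>W (Suc j)\<bar>)"
    using abs_V[of j] by (simp add: abs_mult)
  also have "\<dots> \<le> X (Suc j) * len v / (\<bar>W j\<bar> * \<bar>W (Suc j)\<bar>)"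
    using abs_wedge_le[of ?b v] by (intro divide_right_mono) auto
  finally show ?thesis by (simp add: G_def)
qed

text \<open>The values of each form converge with an error controlled by \<open>G\<close>; the forms
  \<open>(1, 0, 0)\<close> and \<open>(0, 1, 0)\<close> give the coordinates of the limit.\<close>

lemma limit_point:
  obtains x y where "\<And>k v. \<bar>lin x y v - lin (px k) (py k) v\<bar> \<le> 10/9 * (G k * len v)"
proof -
  have lim: "\<exists>L. (\<lambda>j. lin (px j) (py j) v) \<longlonglongrightarrow> L \<and> (\<forall>k. \<bar>L - lin (px k) (py k) v\<bar> \<le> 10/9 * (G k * len v))" for v
  proof -
    have "G (Suc j) * len v \<le> G j * len v / 10" for j
      using mult_right_mono[OF G_step[of j] len_nonneg[of v]] by simp
    then obtain L where "(\<lambda>j. lin (px j) (py j) v) \<longlonglongrightarrow> L"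
      "\<And>k. \<bar>L - lin (px k) (py k) v\<bar> \<le> 10/9 * (G k * len v)"
      using nested_geometric_limit[of "\<lambda>j. lin (px j) (py j) v" "\<lambda>j. G j * len v"] lin_p_diff by blast
    then show ?thesis by blast
  qed
  obtain x where x: "px \<longlonglongrightarrow> x" using lim[of "(1,0,0)"] by auto
  obtain y where y: "py \<longlonglongrightarrow> y" using lim[of "(0,1,0)"] by auto
  show ?thesis
  proof (rule that)
    fix k and v :: ivec
    obtain p q n where v: "v = (p, q, n)" by (cases v)
    have "(\<lambda>j. lin (px j) (py j) v) \<longlonglongrightarrow> lin x y v"
      unfolding v lin.simps by (intro tendsto_intros x y)
    then show "\<bar>lin x y v - lin (px k) (py k) v\<bar> \<le> 10/9 * (G k * len v)"
      using lim[of v] LIMSEQ_unique by blast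
  qed
qed

end

section \<open>Size and sign of the values at the limit point\<close>

locale chain_point = chain +
  fixes x y :: real
  assumes point: "\<bar>lin x y v - lin (px k) (py k) v\<bar> \<le> 10/9 * (G k * len v)"
begin

definition zeta :: "nat \<Rightarrow> real" where "zeta k = lin x y (z k)"

text \<open>At the intersection of the next two lines the form \<open>z k\<close> equals
  \<open>- V k / W (Suc k)\<close> exactly; only the tail beyond that point has to be
  estimated.\<close>

lemma zeta_approx: "\<bar>zeta k * W (Suc k) + V k\<bar> \<le> 2 * w k"
proof -
  let ?X = "X k" and ?X2 = "X (Suc (Suc k))" and ?w = "w (Suc k)" and ?W = "\<bar>W (Suc k)\<bar>"
  \<comment> \<open>After squaring, the growth bounds give the factor 7/10 times 3, which is below
    9/4.\<close>
  have "?w * ?X2 * ?X \<le> 3/2 * (w k * N (Suc k))"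
  proof (rule power2_le_imp_le)
    have "(?w * ?X2 * ?X)\<^sup>2 = ?w * (?w * N (Suc (Suc k))) * N k"
      by (simp add: power_mult_distrib X_squared) (simp add: power2_eq_square)
    also have "\<dots> \<le> w k * (7/10 * N (Suc k)) * (3 * (w k * N (Suc k)))"
    proof (rule mult_mono)
      show "?w * (?w * N (Suc (Suc k))) \<le> w k * (7/10 * N (Suc k))"
        by (rule mult_mono[OF w_dec wN_le]) (use w_pos N_pos in \<open>auto simp: less_imp_le\<close>)
    qed (use wN_ge[of k] w_pos N_pos in \<open>auto simp: less_imp_le\<close>)
    also have "\<dots> \<le> (3/2 * (w k * N (Suc k)))\<^sup>2"
      using w_pos[of k] N_pos[of "Suc k"] by (simp add: power2_eq_square zero_le_mult_iff)
    finally show "(?w * ?X2 * ?X)\<^sup>2 \<le> (3/2 * (w k * N (Suc k)))\<^sup>2" .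
  qed (use w_pos[of k] N_pos[of "Suc k"] in auto)
  moreover have "N (Suc k) \<le> ?w * \<bar>W (Suc (Suc k))\<bar>"
    using W_ge[of "Suc k"] w_pos[of "Suc k"] by (simp add: field_simps)
  then have "w k * N (Suc k) \<le> w k * (?w * \<bar>W (Suc (Suc k))\<bar>)"
    using w_pos[of k] by (intro mult_left_mono) auto
  ultimately have "?w * (?X2 * ?X) \<le> ?w * (3/2 * (w k * \<bar>W (Suc (Suc k))\<bar>))"
    by (simp add: mult_ac)
  then have "?X2 * ?X \<le> 3/2 * (w k * \<bar>W (Suc (Suc k))\<bar>)"
    using w_pos[of "Suc k"] by (simp add: mult_le_cancel_left_pos)
  then have G: "G (Suc k) * ?X * ?W \<le> 3/2 * w k"
    using W_pos[of "Suc k"] W_pos[of "Suc (Suc k)"] unfolding G_def by (simp add: field_simps)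
  have "W (Suc k) \<noteq> 0" using W_pos[of "Suc k"] by auto
  then have "zeta k * W (Suc k) + V k = (lin x y (z k) - lin (px (Suc k)) (py (Suc k)) (z k)) * W (Suc k)"
    unfolding lin_p by (simp add: zeta_def V_def vol_cyclic[of "z (Suc k)"] field_simps)
  then have "\<bar>zeta k * W (Suc k) + V k\<bar> = \<bar>lin x y (z k) - lin (px (Suc k)) (py (Suc k)) (z k)\<bar> * ?W"
    by (simp add: abs_mult)
  also have "\<dots> \<le> 10/9 * (G (Suc k) * ?X) * ?W"
    using point[of "z k" "Suc k"] by (intro mult_right_mono) auto
  also have "\<dots> = 10/9 * (G (Suc k) * ?X * ?W)" by simp
  also have "\<dots> \<le> 2 * w k" using G w_pos[of k] by linarith
  finally show ?thesis .
qed

lemma zeta_W_bounds: "1 - 2 * w k \<le> \<bar>zeta k\<bar> * \<bar>W (Suc k)\<bar>" "\<bar>zeta k\<bar> * \<bar>W (Suc k)\<bar> \<le> 1 + 2 * w k"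
  using zeta_approx[of k] abs_V[of k] unfolding abs_mult[symmetric] by linarith+

lemma zeta_N_le: "\<bar>zeta k\<bar> * N k \<le> w k + 2 * (w k)\<^sup>2"
proof -
  have "\<bar>zeta k\<bar> * (N k / w k) \<le> \<bar>zeta k\<bar> * \<bar>W (Suc k)\<bar>"
    using W_ge[of k] by (intro mult_left_mono) auto
  then have "\<bar>zeta k\<bar> * (N k / w k) \<le> 1 + 2 * w k" using zeta_W_bounds(2)[of k] by linarith
  then show ?thesis using w_pos[of k] by (simp add: field_simps power2_eq_square)
qed

lemma zeta_N_ge: "1 - 2 * w k \<le> \<bar>zeta k\<bar> * N k / w k * (1 + 7/2 * w k)"
proof -
  have "\<bar>zeta k\<bar> * \<bar>W (Suc k)\<bar> \<le> \<bar>zeta k\<bar> * (N k / w k + 7/2 * N k)"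
    using W_le[of k] by (intro mult_left_mono) auto
  also have "\<dots> = \<bar>zeta k\<bar> * N k / w k * (1 + 7/2 * w k)"
    using w_pos[of k] by (simp add: field_simps)
  finally show ?thesis using zeta_W_bounds(1)[of k] by linarith
qed

text \<open>The 9 absorbs the errors 2 (from the tail) and 7/2 (from the excess of the wedge), and
  it stays below \<open>4 * \<gamma>\<close>.\<close>

lemma zeta_N_ge_quadratic: "w k - 9 * (w k)\<^sup>2 \<le> \<bar>zeta k\<bar> * N k"
proof -
  have "(1 - 9 * w k) * (1 + 7/2 * w k) \<le> 1 - 2 * w k"
    using w_pos[of k] by (simp add: algebra_simps)
  also note zeta_N_ge[of k]
  finally have "1 - 9 * w k \<le> \<bar>zeta k\<bar> * N k / w k"
    by (rule mult_right_le_imp_le) (use w_pos[of k] in simp)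
  then show ?thesis using w_pos[of k] by (simp add: field_simps power2_eq_square)
qed

lemma zeta_N_ge_three_quarters: "3/4 * w k \<le> \<bar>zeta k\<bar> * N k"
proof -
  have "3/4 * (1 + 7/2 * w k) \<le> 1 - 2 * w k"
    using w_le[of k] by (simp add: algebra_simps)
  also note zeta_N_ge[of k]
  finally have "3/4 \<le> \<bar>zeta k\<bar> * N k / w k"
    by (rule mult_right_le_imp_le) (use w_pos[of k] in simp)
  then show ?thesis using w_pos[of k] by (simp add: field_simps)
qed

lemma zeta_N_le_linear: "\<bar>zeta k\<bar> * N k \<le> 23/21 * w k"
proof -
  have "(w k)\<^sup>2 \<le> 1/21 * w k" using w_le[of k] w_pos[of k] unfolding power2_eq_square
    by (intro mult_right_mono) auto
  then show ?thesis using zeta_N_le[of k] by linarith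
qed

lemma zeta_pos: "0 < \<bar>zeta k\<bar>"
proof -
  have "0 < \<bar>zeta k\<bar> * N k" using zeta_N_ge_three_quarters[of k] w_pos[of k] by linarith
  then show ?thesis using N_pos[of k] by (simp add: zero_less_mult_iff)
qed

text \<open>Squared lengths grow by 7, and 23/21 times 4/3 divided by 7 is below 1/4.\<close>

lemma zeta_decay: "\<bar>zeta (Suc k)\<bar> \<le> \<bar>zeta k\<bar> / 4"
proof -
  have "\<bar>zeta (Suc k)\<bar> * (7 * N k) \<le> \<bar>zeta (Suc k)\<bar> * N (Suc k)"
    using N_growth[of k] by (intro mult_left_mono) auto
  also have "\<dots> \<le> 23/21 * w k" using zeta_N_le_linear[of "Suc k"] w_dec[of k] by linarith
  finally have "\<bar>zeta (Suc k)\<bar> * N k \<le> \<bar>zeta k\<bar> / 4 * N k" using zeta_N_ge_three_quarters[of k] w_pos[of k] by linarith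
  then show ?thesis using N_pos[of k] by (simp add: mult_le_cancel_right_pos)
qed

text \<open>As \<open>2 * w k < 1\<close>, \<open>zeta_approx\<close> makes
  \<open>zeta k * W (Suc k)\<close> opposite in sign to \<open>V k\<close>;
  \<open>alternating\<close> then applies.\<close>

lemma zeta_alternating: "zeta k * zeta (Suc k) < 0"
proof -
  have sign: "zeta j * W (Suc j) * V j < 0" for j
  proof -
    have "V j = 1 \<or> V j = -1" using abs_V[of j] by linarith
    then show ?thesis using zeta_approx[of j] w_le[of j] by (auto simp: abs_le_iff)
  qed
  have "0 < (zeta k * W (Suc k) * V k) * (zeta (Suc k) * W (Suc (Suc k)) * V (Suc k))"
    using sign[of k] sign[of "Suc k"] by (rule mult_neg_neg)
  also have "\<dots> = (zeta k * zeta (Suc k)) * (V k * V (Suc k) * W (Suc k) * W (Suc (Suc k)))"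
    by (simp add: mult_ac)
  finally have "0 < (zeta k * zeta (Suc k)) * (V k * V (Suc k) * W (Suc k) * W (Suc (Suc k)))" .
  moreover have "V k * V (Suc k) * W (Suc k) * W (Suc (Suc k)) < 0"
    using alternating[of k] unfolding V_def W_def by (metis of_int_less_0_iff of_int_mult)
  moreover have "a < 0" if "0 < a * b" "b < 0" for a b :: real
    using that by (simp add: zero_less_mult_iff)
  ultimately show ?thesis by blast
qed

end

section \<open>Best approximations at the limit point\<close>

context chain_point begin

text \<open>In \<open>wedge_lin\<close> the determinant is a nonzero integer and the other two terms
  total at most 23/30 + 23/882. The remainder exceeds 23/126, which bounds
  \<open>\<bar>W k * zeta k\<bar>\<close>. The 23/30 rests on the upper growth bound 7/10.\<close>

lemma key_outside:
  assumes v: "scal v v < scal (z (Suc k)) (z (Suc k))" and vol: "vol (z k) (z (Suc k)) v \<noteq> 0"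
  shows "\<bar>zeta k\<bar> < \<bar>lin x y v\<bar>"
proof -
  let ?a = "z k" and ?b = "z (Suc k)"
  have lv: "len v \<le> X (Suc k)" using v by (simp add: len_def)
  have "1 \<le> \<bar>real_of_int (vol ?a ?b v)\<bar>" using vol by linarith
  moreover have "W k * lin x y v = wedge v ?b * zeta k + wedge ?a v * zeta (Suc k) - vol ?a ?b v"
    using wedge_lin[of ?a ?b x y v] by (simp add: W_def zeta_def)
  moreover have "\<bar>wedge v ?b * zeta k\<bar> \<le> 23/30"
  proof -
    have "\<bar>real_of_int (wedge v ?b)\<bar> \<le> len v * X (Suc k)" by (rule abs_wedge_le)
    also have "\<dots> \<le> X (Suc k) * X (Suc k)" using lv len_nonneg by (intro mult_right_mono) auto
    also have "\<dots> = N (Suc k)" by (metis X_squared power2_eq_square)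
    finally have "\<bar>wedge v ?b * zeta k\<bar> \<le> N (Suc k) * \<bar>zeta k\<bar>"
      by (simp add: abs_mult mult_right_mono)
    moreover have "w k * N (Suc k) * \<bar>zeta k\<bar> \<le> 7/10 * N k * \<bar>zeta k\<bar>"
      using wN_le[of k] by (intro mult_right_mono) auto
    then have "w k * (N (Suc k) * \<bar>zeta k\<bar>) \<le> w k * (23/30)"
      using zeta_N_le_linear[of k] by (simp add: mult_ac)
    then have "N (Suc k) * \<bar>zeta k\<bar> \<le> 23/30" using w_pos[of k] by (simp only: mult_le_cancel_left_pos)
    ultimately show ?thesis by linarith
  qed
  moreover have "\<bar>wedge ?a v * zeta (Suc k)\<bar> \<le> 23/882"
  proof -
    have "\<bar>real_of_int (wedge ?a v)\<bar> \<le> X k * len v" by (rule abs_wedge_le)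
    also have "\<dots> \<le> (X (Suc k) / 2) * X (Suc k)"
      using lv len_nonneg X_growth[of k] by (intro mult_mono) auto
    also have "\<dots> = N (Suc k) / 2" using X_squared[of "Suc k"] by (simp add: power2_eq_square)
    finally have "\<bar>wedge ?a v * zeta (Suc k)\<bar> \<le> N (Suc k) / 2 * \<bar>zeta (Suc k)\<bar>"
      unfolding abs_mult by (intro mult_right_mono) auto
    then show ?thesis using zeta_N_le_linear[of "Suc k"] w_le[of "Suc k"] by (simp add: mult.commute)
  qed
  moreover have "\<bar>W k\<bar> * \<bar>zeta k\<bar> \<le> 23/126"
  proof -
    have "\<bar>W k\<bar> * \<bar>zeta k\<bar> \<le> 7/2 * N k * \<bar>zeta k\<bar>"
      using W_bound[of k] by (intro mult_right_mono) auto
    then show ?thesis using zeta_N_le_linear[of k] w_le[of k] by (simp add: mult_ac)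
  qed
  ultimately have "\<bar>W k\<bar> * \<bar>zeta k\<bar> < \<bar>W k\<bar> * \<bar>lin x y v\<bar>"
    unfolding abs_mult[symmetric, of "W k" "lin x y v"] by linarith
  then show ?thesis using W_pos[of k] by (simp only: mult_less_cancel_left_pos)
qed

text \<open>Shortness of \<open>v\<close> restricts \<open>s\<close> and \<open>t\<close>:
  \<open>s = 0\<close> is impossible, \<open>\<bar>s\<bar> = 1\<close> forces opposite signs, and
  larger \<open>\<bar>s\<bar>\<close> keeps the first term of the value dominant.\<close>

lemma key_inside:
  assumes v: "v = comb s (z k) t (z (Suc k)) 0 c"
    and less: "scal v v < scal (z (Suc k)) (z (Suc k))" and nz: "scal v v \<noteq> 0"
    and ne: "t = 0 \<Longrightarrow> \<bar>s\<bar> \<noteq> 1"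
  shows "\<bar>zeta k\<bar> < \<bar>lin x y v\<bar>"
proof -
  let ?a = "z k" and ?b = "z (Suc k)"
  have vv: "scal v v = s\<^sup>2 * scal ?a ?a + 2 * (s * t) * scal ?a ?b + t\<^sup>2 * scal ?b ?b"
    unfolding v by (cases ?a; cases ?b; cases c) (simp add: algebra_simps power2_eq_square)
  have lin: "lin x y v = s * zeta k + t * zeta (Suc k)"
    unfolding v lin_comb by (simp add: zeta_def)
  have bb: "0 < scal ?b ?b" and aa: "0 < scal ?a ?a"
    using N_pos[of "Suc k"] N_pos[of k] by (auto simp: N_def)
  consider "s = 0" | "\<bar>s\<bar> = 1" | "2 \<le> \<bar>s\<bar>" by linarith
  then show ?thesis
  proof cases
    case 1
    then have "t \<noteq> 0" using nz vv by auto
    then have "1 \<le> t\<^sup>2" by (simp add: int_one_le_iff_zero_less)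
    then have "1 * scal ?b ?b \<le> t\<^sup>2 * scal ?b ?b" using bb by (intro mult_right_mono) auto
    then show ?thesis using less vv 1 by simp
  next
    case 2
    then have t: "t \<noteq> 0" using ne by auto
    then have t2: "1 \<le> t\<^sup>2" by (simp add: int_one_le_iff_zero_less)
    have s2: "s\<^sup>2 = 1" using 2 by (metis one_power2 power2_abs)
    \<comment> \<open>The angle is acute, so coefficients of equal sign would make \<open>v\<close>
      at least as long as \<open>z (Suc k)\<close>.\<close>
    have "s * t < 0"
    proof (rule ccontr)
      assume "\<not> s * t < 0"
      then have "0 \<le> 2 * (s * t) * scal ?a ?b" using scal_pos[of k] by simp
      moreover have "1 * scal ?b ?b \<le> t\<^sup>2 * scal ?b ?b" using bb t2 by (intro mult_right_mono) auto
      ultimately show False using less aa unfolding vv s2 by linarith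
    qed
    then have st: "real_of_int s * real_of_int t < 0" by (metis of_int_less_0_iff of_int_mult)
    have "0 < (real_of_int s * real_of_int t) * (zeta k * zeta (Suc k))"
      using st zeta_alternating[of k] by (rule mult_neg_neg)
    then have "0 < (s * zeta k) * (t * zeta (Suc k))" by (simp add: mult_ac)
    \<comment> \<open>Opposite coefficients meet values of opposite signs, so nothing
      cancels.\<close>
    then have "\<bar>lin x y v\<bar> = \<bar>s * zeta k\<bar> + \<bar>t * zeta (Suc k)\<bar>"
      unfolding lin by (auto simp: zero_less_mult_iff[of "s * zeta k"] abs_if)
    moreover have "0 < \<bar>t * zeta (Suc k)\<bar>" using t zeta_pos[of "Suc k"] by simp
    moreover have "\<bar>s * zeta k\<bar> = \<bar>zeta k\<bar>"
      using 2 by (metis abs_mult mult_1 of_int_1 of_int_abs)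
    ultimately show ?thesis by linarith
  next
    case 3
    let ?s = "\<bar>real_of_int s\<bar>" and ?t = "\<bar>real_of_int t\<bar>"
    have s2: "2 \<le> ?s" using 3 by linarith
    \<comment> \<open>The reverse triangle inequality, squared; it yields
      \<open>?t < 1 + ?s / 2\<close>, which the decay of \<open>zeta\<close> turns into the
      claim.\<close>
    have "(?t * X (Suc k) - ?s * X k)\<^sup>2 < (X (Suc k))\<^sup>2"
    proof -
      have "\<bar>real_of_int (2 * (s * t) * scal ?a ?b)\<bar> = 2 * (?s * ?t) * \<bar>real_of_int (scal ?a ?b)\<bar>"
        by (simp add: abs_mult)
      also have "\<dots> \<le> 2 * (?s * ?t) * (X k * X (Suc k))"
        using abs_scal_le[of ?a ?b] by (intro mult_left_mono) auto
      finally have "- (2 * (?s * ?t) * (X k * X (Suc k))) \<le> real_of_int (2 * (s * t) * scal ?a ?b)"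
        by linarith
      moreover have "real_of_int (scal v v) = ?s\<^sup>2 * N k + real_of_int (2 * (s * t) * scal ?a ?b) + ?t\<^sup>2 * N (Suc k)"
        unfolding vv by (simp add: N_def)
      moreover have "(?t * X (Suc k) - ?s * X k)\<^sup>2 =
          ?s\<^sup>2 * N k - 2 * (?s * ?t) * (X k * X (Suc k)) + ?t\<^sup>2 * N (Suc k)"
        unfolding X_squared[symmetric] by (simp add: power2_diff power_mult_distrib)
      moreover have "real_of_int (scal v v) < (X (Suc k))\<^sup>2"
        using less by (simp add: len_squared)
      ultimately show ?thesis by linarith
    qed
    then have "?t * X (Suc k) - ?s * X k < X (Suc k)"
      by (rule power_less_imp_less_base) (rule len_nonneg)
    moreover have "?s * (2 * X k) \<le> ?s * X (Suc k)" using X_growth[of k] by (intro mult_left_mono) auto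
    ultimately have "?t * X (Suc k) < (1 + ?s / 2) * X (Suc k)" by (simp add: algebra_simps)
    then have t: "?t < 1 + ?s / 2" using X_pos[of "Suc k"] by (simp only: mult_less_cancel_right_pos)
    have "?t * \<bar>zeta (Suc k)\<bar> \<le> (1 + ?s / 2) * (\<bar>zeta k\<bar> / 4)"
      using t zeta_decay[of k] by (intro mult_mono) auto
    moreover have "?s * \<bar>zeta k\<bar> - ?t * \<bar>zeta (Suc k)\<bar> \<le> \<bar>lin x y v\<bar>"
      unfolding lin abs_mult[symmetric] by linarith
    moreover have "2 * \<bar>zeta k\<bar> \<le> ?s * \<bar>zeta k\<bar>" using s2 by (intro mult_right_mono) auto
    moreover have "(1 + ?s / 2) * (\<bar>zeta k\<bar> / 4) = \<bar>zeta k\<bar> / 4 + ?s * \<bar>zeta k\<bar> / 8"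
      by (simp add: algebra_simps)
    ultimately show ?thesis using zeta_pos[of k] by linarith
  qed
qed

abbreviation neg :: "ivec \<Rightarrow> ivec" where "neg v \<equiv> comb (-1) v 0 v 0 v"

lemma key:
  assumes "scal v v < scal (z (Suc k)) (z (Suc k))" "scal v v \<noteq> 0" "v \<noteq> z k" "v \<noteq> neg (z k)"
  shows "\<bar>zeta k\<bar> < \<bar>lin x y v\<bar>"
proof (cases "vol (z k) (z (Suc k)) v = 0")
  case False then show ?thesis using key_outside assms by blast
next
  case True
  obtain s t u where c: "v = comb s (z k) t (z (Suc k)) u (z (Suc (Suc k)))" "u = 0"
    using comb_of_vol[OF vol_unit[of k]] True by metis
  have "\<bar>s\<bar> \<noteq> 1" if "t = 0"
  proof
    assume "\<bar>s\<bar> = 1"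
    then have "s = 1 \<or> s = -1" by linarith
    then show False using assms(3,4) c that
      by (cases "z k"; cases "z (Suc k)"; cases "z (Suc (Suc k))") auto
  qed
  then show ?thesis using key_inside[of v s k t] c assms by blast
qed

end

section \<open>From integer vectors to lattice points of the plane\<close>

fun emb :: "ivec \<Rightarrow> real ^ 2"
  where "emb (p, q, n) = vector [of_int p, of_int q]"

lemma norm_emb: "norm (emb v) = len v"
  by (cases v) (simp add: norm_vec_def L2_set_def sum_2 len_def power2_eq_square)

lemma inner_emb: "emb u \<bullet> emb v = scal u v"
  by (cases u; cases v) (simp add: inner_vec_def sum_2)

lemma emb_in_lattice: "emb v \<in> int_lattice"
  by (cases v) (auto simp: int_lattice_def forall_2)

lemma emb_eq_0_iff: "emb v = 0 \<longleftrightarrow> scal v v = 0"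
  using inner_eq_zero_iff[of "emb v"] unfolding inner_emb by simp

lemma emb_neg: "emb (comb (-1) v 0 u 0 t) = - emb v"
  by (cases v; cases u; cases t) (simp add: vec_eq_iff forall_2)

lemma lin_inner: "lin x y v = vector [x, y] \<bullet> emb v - of_int (snd (snd v))"
  by (cases v) (simp add: inner_vec_def sum_2 mult.commute)

lemma dist_to_int_le_lin: "dist_to_int (vector [x, y] \<bullet> emb v) \<le> \<bar>lin x y v\<bar>"
  unfolding lin_inner dist_to_int_eq_round by (rule round_diff_minimal)

text \<open>The lift takes the nearest integer as its third coordinate.\<close>

lemma lattice_emb:
  assumes "m \<in> int_lattice"
  obtains v where "m = emb v" "dist_to_int (vector [x, y] \<bullet> m) = \<bar>lin x y v\<bar>"
proof -
  obtain p q where pq: "m $ 1 = of_int p" "m $ 2 = of_int q"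
    using assms unfolding int_lattice_def by (metis (mono_tags, lifting) Ints_cases mem_Collect_eq)
  let ?v = "(p, q, round (vector [x, y] \<bullet> m))"
  have m: "m = emb ?v" using pq by (simp add: vec_eq_iff forall_2)
  show ?thesis
    by (rule that[OF m]) (unfold lin_inner dist_to_int_eq_round m[symmetric], simp)
qed

lemma dist_to_int_minus: "dist_to_int (- t) = dist_to_int t"
proof -
  have "dist_to_int (- t) \<le> dist_to_int t" for t
    using round_diff_minimal[of "- t" "- round t"] unfolding dist_to_int_eq_round by simp
  from this[of t] this[of "- t"] show ?thesis by simp
qed

context chain_point begin

abbreviation \<alpha> :: "real ^ 2" where "\<alpha> \<equiv> vector [x, y]"

lemma norm_emb_less: "norm (emb u) < norm (emb v) \<longleftrightarrow> scal u u < scal v v"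
  by (simp add: norm_emb len_def)

lemma scal_z_pos: "0 < scal (z k) (z k)"
  using N_pos[of k] by (simp add: N_def)

lemma scal_z_less: "scal (z k) (z k) < scal (z (Suc k)) (z (Suc k))"
  using N_growth[of k] N_pos[of k] unfolding N_def by linarith

lemma key_dist:
  assumes "m \<in> int_lattice - {0}" "norm m < norm (emb (z (Suc k)))" "m \<noteq> emb (z k)" "m \<noteq> - emb (z k)"
  shows "\<bar>zeta k\<bar> < dist_to_int (\<alpha> \<bullet> m)"
proof -
  obtain v where v: "m = emb v" "dist_to_int (\<alpha> \<bullet> m) = \<bar>lin x y v\<bar>"
    using lattice_emb[of m x y] assms by blast
  show ?thesis unfolding v(2)
    using assms unfolding v(1) by (intro key) (auto simp: norm_emb_less emb_eq_0_iff emb_neg)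
qed

text \<open>The lift of the same lattice point with the nearest integer has the same length and a
  value no larger in modulus, so \<open>key\<close> leaves only \<open>z k\<close> and its
  negative.\<close>

lemma dist_z: "dist_to_int (\<alpha> \<bullet> emb (z k)) = \<bar>zeta k\<bar>"
proof -
  obtain v where v: "emb (z k) = emb v" "dist_to_int (\<alpha> \<bullet> emb (z k)) = \<bar>lin x y v\<bar>"
    using lattice_emb[OF emb_in_lattice] by blast
  have le: "\<bar>lin x y v\<bar> \<le> \<bar>zeta k\<bar>"
    using dist_to_int_le_lin[of x y "z k"] v by (simp add: zeta_def)
  have vv: "scal v v = scal (z k) (z k)"
    using v(1) by (metis inner_emb of_int_eq_iff)
  have "v = z k \<or> v = neg (z k)"
    using key[of v k] le scal_z_pos[of k] scal_z_less[of k] unfolding vv by linarith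
  then have "\<bar>lin x y v\<bar> = \<bar>zeta k\<bar>" by (auto simp: zeta_def lin_comb)
  then show ?thesis using v(2) by simp
qed

lemma unbounded: "\<exists>k. real n < N k"
proof (induction n)
  case 0 then show ?case using N_pos by auto
next
  case (Suc n)
  then obtain k where "real n < N k" by blast
  moreover have "1 \<le> N k" using scal_z_pos[of k] by (simp add: N_def)
  ultimately have "real (Suc n) < N (Suc k)" using N_growth[of k] by simp
  then show ?case by blast
qed

lemma best_approximation_iff:
  "best_approximation \<alpha> m \<longleftrightarrow> (\<exists>k. m = emb (z k) \<or> m = - emb (z k))"
proof
  assume "\<exists>k. m = emb (z k) \<or> m = - emb (z k)"
  then obtain k where k: "m = emb (z k) \<or> m = - emb (z k)" by blast
  have dist: "dist_to_int (\<alpha> \<bullet> m) = \<bar>zeta k\<bar>" using k dist_z[of k] dist_to_int_minus by auto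
  have norm: "norm m = norm (emb (z k))" using k by auto
  have less: "norm (emb (z k)) < norm (emb (z (Suc k)))" using scal_z_less norm_emb_less by blast
  have nz: "emb (z k) \<noteq> 0" using scal_z_pos[of k] by (simp add: emb_eq_0_iff)
  have "- emb (z k) \<in> int_lattice" using emb_in_lattice[of "neg (z k)"] unfolding emb_neg .
  then have "m \<in> int_lattice - {0}" using k nz emb_in_lattice[of "z k"] by auto
  then show "best_approximation \<alpha> m"
    unfolding best_approximation_def dist norm
  proof (intro conjI ballI impI)
    fix m' assume "m' \<in> int_lattice - {0}" "norm m' < norm (emb (z k))"
    then show "\<bar>zeta k\<bar> < dist_to_int (\<alpha> \<bullet> m')" using less by (intro key_dist) auto
  next
    fix m' assume m': "m' \<in> int_lattice - {m, - m}" "norm m' = norm (emb (z k))"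
    then have "m' \<noteq> 0" using nz by auto
    then have "\<bar>zeta k\<bar> < dist_to_int (\<alpha> \<bullet> m')" using less m' k by (intro key_dist) auto
    then show "\<bar>zeta k\<bar> \<le> dist_to_int (\<alpha> \<bullet> m')" by simp
  qed
next
  assume best: "best_approximation \<alpha> m"
  then have m: "m \<in> int_lattice - {0}" by (simp add: best_approximation_def)
  then obtain v where v: "m = emb v" using lattice_emb[of m x y] by blast
  then have "0 < scal v v" using m scal_self_nonneg[of v] by (auto simp: emb_eq_0_iff less_le)
  then have v0: "\<not> scal v v < scal (z 0) (z 0)" by (simp add: z_0)
  \<comment> \<open>This brackets the length of \<open>m\<close> between those of \<open>z k\<close>
    and \<open>z (Suc k)\<close>; for \<open>k = 0\<close> the lower bound holds because nonzero
    integer vectors have length at least 1.\<close>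
  define k where "k = (LEAST k. scal v v < scal (z (Suc k)) (z (Suc k)))"
  obtain j where "real (nat (scal v v)) < N j" using unbounded by blast
  then have j: "scal v v < scal (z j) (z j)" using \<open>0 < scal v v\<close> by (simp add: N_def)
  then obtain i where "scal v v < scal (z (Suc i)) (z (Suc i))" using v0 by (cases j) auto
  then have k1: "scal v v < scal (z (Suc k)) (z (Suc k))" unfolding k_def by (rule LeastI)
  have k2: "\<not> scal v v < scal (z k) (z k)"
  proof (cases k)
    case (Suc i)
    then have "\<not> scal v v < scal (z (Suc i)) (z (Suc i))"
      by (intro not_less_Least[where P = "\<lambda>k. scal v v < scal (z (Suc k)) (z (Suc k))"]) (simp add: k_def)
    then show ?thesis using Suc by simp
  qed (use v0 in simp)
  have "m = emb (z k) \<or> m = - emb (z k)"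
  proof (rule ccontr)
    assume ne: "\<not> ?thesis"
    \<comment> \<open>Thus \<open>emb (z k)\<close>, which is no longer than \<open>m\<close>, has a
      strictly smaller distance, against the choice of \<open>m\<close>.\<close>
    have lt: "\<bar>zeta k\<bar> < dist_to_int (\<alpha> \<bullet> m)"
      using ne m k1 unfolding v by (intro key_dist) (auto simp: norm_emb_less)
    have in1: "emb (z k) \<in> int_lattice - {0}"
      using emb_in_lattice[of "z k"] scal_z_pos[of k] by (simp add: emb_eq_0_iff)
    have in2: "emb (z k) \<in> int_lattice - {m, - m}"
      using emb_in_lattice[of "z k"] ne by auto
    have "\<not> norm m < norm (emb (z k))" using k2 unfolding v norm_emb_less .
    then consider "norm (emb (z k)) < norm m" | "norm (emb (z k)) = norm m" by linarith
    then have "dist_to_int (\<alpha> \<bullet> m) \<le> dist_to_int (\<alpha> \<bullet> emb (z k))"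
    proof cases
      case 1 then show ?thesis using best in1 unfolding best_approximation_def by (blast intro: less_imp_le)
    next
      case 2 then show ?thesis using best in2 unfolding best_approximation_def by blast
    qed
    then show False using lt unfolding dist_z by simp
  qed
  then show "\<exists>k. m = emb (z k) \<or> m = - emb (z k)" by blast
qed

end

section \<open>Recovering the chain from its limit point\<close>

lemma strict_mono_range_eq:
  fixes f g :: "nat \<Rightarrow> 'a :: linorder"
  assumes "strict_mono f" "strict_mono g" "range f = range g"
  shows "f = g"
proof
  have le: "g n \<le> f n" if h: "strict_mono f" "strict_mono g" "range f \<subseteq> range g" "\<forall>i<n. f i = g i" for f g :: "nat \<Rightarrow> 'a" and n
  proof -
    obtain j where j: "f n = g j" using h(3) by blast
    have "\<not> j < n" using h j by (metis less_irrefl strict_mono_less)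
    then show ?thesis using h(2) j by (simp add: strict_mono_less_eq)
  qed
  show "f n = g n" for n
  proof (induction n rule: less_induct)
    case (less n)
    then show ?case using le[of f g n] le[of g f n] assms by (intro antisym) auto
  qed
qed

text \<open>Both chains list the best approximations by increasing length, so they agree up to sign;
  the common start and the acute angles fix the signs inductively.\<close>

lemma chain_point_unique:
  assumes "chain_point z w x y" "chain_point z' w' x y"
  shows "emb (z k) = emb (z' k)"
proof -
  interpret c: chain_point z w x y by fact
  interpret c': chain_point z' w' x y by fact
  have iff: "(\<exists>k. m = emb (z k) \<or> m = - emb (z k)) \<longleftrightarrow> (\<exists>k. m = emb (z' k) \<or> m = - emb (z' k))" for m
    using c.best_approximation_iff[of m] c'.best_approximation_iff[of m] by simp
  have sub1: "norm (emb (z k)) \<in> range (\<lambda>k. norm (emb (z' k)))" for k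
  proof -
    obtain j where "emb (z k) = emb (z' j) \<or> emb (z k) = - emb (z' j)" using iff[of "emb (z k)"] by blast
    then have "norm (emb (z k)) = norm (emb (z' j))" by auto
    then show ?thesis by simp
  qed
  have sub2: "norm (emb (z' k)) \<in> range (\<lambda>k. norm (emb (z k)))" for k
  proof -
    obtain j where "emb (z' k) = emb (z j) \<or> emb (z' k) = - emb (z j)" using iff[of "emb (z' k)"] by blast
    then have "norm (emb (z' k)) = norm (emb (z j))" by auto
    then show ?thesis by simp
  qed
  have mono: "strict_mono (\<lambda>k. norm (emb (z k)))" "strict_mono (\<lambda>k. norm (emb (z' k)))"
    using c.scal_z_less c'.scal_z_less by (simp_all add: strict_mono_Suc_iff c.norm_emb_less)
  have norms: "(\<lambda>k. norm (emb (z k))) = (\<lambda>k. norm (emb (z' k)))"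
    by (rule strict_mono_range_eq[OF mono]) (use sub1 sub2 in blast)
  have pm: "emb (z k) = emb (z' k) \<or> emb (z k) = - emb (z' k)" for k
  proof -
    obtain j where j: "emb (z k) = emb (z' j) \<or> emb (z k) = - emb (z' j)" using iff[of "emb (z k)"] by blast
    then have "norm (emb (z k)) = norm (emb (z' j))" by auto
    then have "norm (emb (z' k)) = norm (emb (z' j))" using fun_cong[OF norms, of k] by simp
    then have "k = j" using strict_mono_eq[OF mono(2), of k j] by simp
    then show ?thesis using j by simp
  qed
  show ?thesis
  proof (induction k)
    case 0 show ?case by (simp add: c.z_0 c'.z_0)
  next
    case (Suc k)
    have "emb (z k) \<bullet> emb (z (Suc k)) > 0" "emb (z' k) \<bullet> emb (z' (Suc k)) > 0"
      using c.scal_pos[of k] c'.scal_pos[of k] by (simp_all add: inner_emb)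
    then show ?case using pm[of "Suc k"] Suc by auto
  qed
qed

lemma wedge_emb: "real_of_int (wedge a b) = emb a $ 1 * emb b $ 2 - emb a $ 2 * emb b $ 1"
  by (cases a; cases b) simp

lemma wedge_emb_cong:
  assumes "emb a = emb a'" "emb b = emb b'"
  shows "wedge a b = wedge a' b'"
  using wedge_emb[of a b] wedge_emb[of a' b'] assms by simp

section \<open>Existence of chains and the cardinality of the solution set\<close>

text \<open>Dependent choice on triples of consecutive vectors, with \<open>chain_step\<close> as
  successor; \<open>A\<close> prescribes the orientations.\<close>

lemma chain_exists:
  fixes \<psi> :: "real \<Rightarrow> real" and A :: "nat set"
  assumes pos: "\<forall>x>0. 0 < \<psi> x" and anti: "antimono_on {0<..} \<psi>" and le: "\<psi> 1 \<le> 1/21"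
  obtains z where "chain z (\<lambda>k. \<psi> (len (z k)))"
    "\<And>k. 0 < wedge (z (Suc k)) (z (Suc (Suc k))) \<longleftrightarrow> k \<in> A"
proof -
  define g where "g v = \<psi> (len v)" for v
  have len1: "1 \<le> len v" if "1 \<le> scal v v" for v using that by (simp add: len_def)
  have antiD: "\<psi> y \<le> \<psi> x" if "0 < x" "x \<le> y" for x y
    using monotone_onD[OF anti, of x y] that by simp
  have gpos: "0 < g v" if "1 \<le> scal v v" for v using pos len1[OF that] by (simp add: g_def)
  have gle: "g v \<le> 1/21" if "1 \<le> scal v v" for v
    using antiD[of 1 "len v"] len1[OF that] le by (simp add: g_def)
  define s :: "nat \<Rightarrow> int" where "s k = (if k \<in> A then 1 else -1)" for k
  have s1: "\<bar>s k\<bar> = 1" for k by (simp add: s_def)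
  define P where "P k = (\<lambda>(a, b, c). (k = 0 \<longrightarrow> b = (1, 0, 0)) \<and> \<bar>vol a b c\<bar> = 1 \<and> wedge b c \<noteq> 0 \<and>
    \<bar>wedge b c\<bar> \<le> 7/2 * real_of_int (scal b b) \<and> 0 < scal b c \<and> 1 \<le> scal b b \<and>
    scal b b / 3 \<le> g b * scal c c \<and> g b * scal c c \<le> 7/10 * real_of_int (scal b b))" for k :: nat
  define R where "R k = (\<lambda>(a, b, c) (b', c', d). b' = b \<and> c' = c \<and>
    vol b c d = - sgn (wedge b c) * s k * vol a b c \<and>
    scal b b / g b \<le> s k * wedge c d \<and> s k * wedge c d \<le> scal b b / g b + \<bar>wedge b c\<bar>)" for k
  have "\<exists>f. \<forall>k. P k (f k) \<and> R k (f k) (f (Suc k))"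
  proof (rule dependent_nat_choice)
    have "0 < \<psi> 1" using pos by simp
    then have "21 \<le> 1 / \<psi> 1" using le by (simp add: field_simps)
    then obtain r0 where r0: "0 \<le> r0" "\<And>r. r0 < r \<Longrightarrow> r \<le> r0 + 1 \<Longrightarrow>
        (1 / \<psi> 1) / 3 \<le> 1 + r\<^sup>2 \<and> 1 + r\<^sup>2 \<le> 7/10 * (1 / \<psi> 1)"
      using norm_window[of 1 "1 / \<psi> 1"] by auto
    define r where "r = \<lfloor>r0 + 1\<rfloor>"
    have r: "r0 < r" "r \<le> r0 + 1" unfolding r_def by linarith+
    have "1/3 \<le> \<psi> 1 * (1 + (real_of_int r)\<^sup>2)" "\<psi> 1 * (1 + (real_of_int r)\<^sup>2) \<le> 7/10"
      using r0(2)[OF r] \<open>0 < \<psi> 1\<close> by (auto simp: field_simps)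
    moreover have "0 < r" using r r0 by linarith
    \<comment> \<open>The predecessor \<open>(0, 0, 1)\<close> only starts the recursion with
      determinant 1; \<open>r\<close> puts the length of the second chain vector into its
      window.\<close>
    ultimately have "P 0 ((0, 0, 1), (1, 0, 0), (r, 1, 0))"
      by (simp add: P_def g_def len_def power2_eq_square add.commute)
    then show "\<exists>x. P 0 x" by blast
  next
    fix x :: "ivec \<times> ivec \<times> ivec" and k
    obtain a b c where x: "x = (a, b, c)" by (cases x)
    assume "P k x"
    then have p: "\<bar>vol a b c\<bar> = 1" "wedge b c \<noteq> 0" "\<bar>wedge b c\<bar> \<le> 7/2 * real_of_int (scal b b)"
      "0 < scal b c" "1 \<le> scal b b" "scal b b / 3 \<le> g b * scal c c"
      by (auto simp: P_def x)
    have "scal c c \<noteq> 0" using p(4) wedge_scal_squares[of b c] by (auto simp: sum_power2_eq_zero_iff)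
    then have c1: "1 \<le> scal c c" using scal_self_nonneg[of c] by linarith
    obtain d where d: "vol b c d = - sgn (wedge b c) * s k * vol a b c"
      "scal b b / g b \<le> s k * wedge c d" "s k * wedge c d \<le> scal b b / g b + \<bar>wedge b c\<bar>"
      "s k * wedge c d \<le> 7/2 * real_of_int (scal c c)"
      "0 < scal c d" "scal c c / 3 \<le> g c * scal d d" "g c * scal d d \<le> 7/10 * real_of_int (scal c c)"
      by (rule chain_step[OF p(1-3) gpos[OF p(5)] gle[OF p(5)] gpos[OF c1] gle[OF c1] p(6) s1[of k]])
    have "0 < scal b b / g b" using p(5) gpos[OF p(5)] by simp
    then have "0 < real_of_int (s k * wedge c d)" using d(2) by linarith
    then have sw: "0 < s k * wedge c d" by (simp only: of_int_0_less_iff)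
    have aw: "\<bar>wedge c d\<bar> = s k * wedge c d"
      using sw s1[of k] by (metis abs_mult abs_of_pos mult_1)
    have "\<bar>vol b c d\<bar> = 1" using d(1) p(1,2) s1[of k] by (simp add: abs_mult abs_sgn_eq)
    moreover have "wedge c d \<noteq> 0" using sw by auto
    moreover have "\<bar>wedge c d\<bar> \<le> 7/2 * real_of_int (scal c c)" using d(4) unfolding aw .
    ultimately have "P (Suc k) (b, c, d)" using d c1 unfolding P_def by simp
    moreover have "R k x (b, c, d)" using d(1-3) unfolding R_def x by simp
    ultimately show "\<exists>y. P (Suc k) y \<and> R k x y" by blast
  qed
  then obtain f where f: "\<And>k. P k (f k)" "\<And>k. R k (f k) (f (Suc k))" by blast
  \<comment> \<open>The middle component, so that the auxiliary predecessor is left out of the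
    chain.\<close>
  define z where "z k = fst (snd (f k))" for k
  define e where "e k = fst (f k)" for k
  have fz: "f k = (e k, z k, z (Suc k))" for k
    using f(2)[of k] unfolding R_def z_def e_def by (auto split: prod.splits)
  have e_Suc: "e (Suc k) = z k" for k
    using f(2)[of k] unfolding R_def z_def e_def by (auto split: prod.splits)
  have p: "\<bar>vol (e k) (z k) (z (Suc k))\<bar> = 1" "wedge (z k) (z (Suc k)) \<noteq> 0"
      "\<bar>wedge (z k) (z (Suc k))\<bar> \<le> 7/2 * real_of_int (scal (z k) (z k))"
      "0 < scal (z k) (z (Suc k))" "1 \<le> scal (z k) (z k)"
      "scal (z k) (z k) / 3 \<le> g (z k) * scal (z (Suc k)) (z (Suc k))"
      "g (z k) * scal (z (Suc k)) (z (Suc k)) \<le> 7/10 * real_of_int (scal (z k) (z k))" for k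
    using f(1)[of k] unfolding fz[of k] by (simp_all add: P_def)
  have p0: "z 0 = (1, 0, 0)" using f(1)[of 0] unfolding fz[of 0] by (simp add: P_def)
  have q: "vol (z k) (z (Suc k)) (z (Suc (Suc k))) = - sgn (wedge (z k) (z (Suc k))) * s k * vol (e k) (z k) (z (Suc k))"
      "scal (z k) (z k) / g (z k) \<le> s k * wedge (z (Suc k)) (z (Suc (Suc k)))"
      "s k * wedge (z (Suc k)) (z (Suc (Suc k))) \<le> scal (z k) (z k) / g (z k) + \<bar>wedge (z k) (z (Suc k))\<bar>" for k
    using f(2)[of k] unfolding fz by (simp_all add: R_def)
  have sw: "0 < s k * wedge (z (Suc k)) (z (Suc (Suc k)))" for k
  proof -
    have "0 < scal (z k) (z k) / g (z k)" using p(5)[of k] gpos[OF p(5)] by simp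
    then have "0 < real_of_int (s k * wedge (z (Suc k)) (z (Suc (Suc k))))" using q(2)[of k] by linarith
    then show ?thesis by (simp only: of_int_0_less_iff)
  qed
  have aw: "\<bar>wedge (z (Suc k)) (z (Suc (Suc k)))\<bar> = s k * wedge (z (Suc k)) (z (Suc (Suc k)))" for k
    using sw[of k] s1[of k] by (metis abs_mult abs_of_pos mult_1)
  have unit: "\<bar>vol (z k) (z (Suc k)) (z (Suc (Suc k)))\<bar> = 1" for k
    using p(1)[of "Suc k"] by (simp only: e_Suc)
  have glen: "g (z (Suc k)) \<le> g (z k)" for k
  proof -
    have "real_of_int (scal (z k) (z k)) / 3 \<le> 1/21 * scal (z (Suc k)) (z (Suc k))"
      using p(6)[of k] gle[OF p(5)[of k]] p(5)[of "Suc k"]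
      by (smt (verit) mult_right_mono of_int_1 of_int_le_iff)
    then have "len (z k) \<le> len (z (Suc k))" using p(5)[of k] by (simp add: len_def)
    then show ?thesis unfolding g_def using len1[OF p(5)[of k]] by (intro antiD) auto
  qed
  have "chain z (\<lambda>k. g (z k))"
  proof
    fix k
    let ?V = "vol (z k) (z (Suc k)) (z (Suc (Suc k)))" and ?w = "wedge (z (Suc k)) (z (Suc (Suc k)))"
      and ?w' = "wedge (z (Suc (Suc k))) (z (Suc (Suc (Suc k))))"
    have V': "vol (z (Suc k)) (z (Suc (Suc k))) (z (Suc (Suc (Suc k)))) = - sgn ?w * s (Suc k) * ?V"
      using q(1)[of "Suc k"] by (simp only: e_Suc)
    have "?V * ?V = 1" using unit[of k] by (simp add: abs_if split: if_splits)
    \<comment> \<open>The square of the determinant drops out, leaving minus a product of two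
      positive wedge moduli.\<close>
    then have "?V * (- sgn ?w * s (Suc k) * ?V) * ?w * ?w' = - (sgn ?w * ?w) * (s (Suc k) * ?w')"
      by (simp add: algebra_simps)
    also have "sgn ?w * ?w = \<bar>?w\<bar>" by (simp add: abs_sgn mult.commute)
    also have "- \<bar>?w\<bar> * (s (Suc k) * ?w') < 0"
      using sw[of "Suc k"] p(2)[of "Suc k"] by (simp add: mult_less_0_iff)
    finally show "?V * vol (z (Suc k)) (z (Suc (Suc k))) (z (Suc (Suc (Suc k)))) * ?w * ?w' < 0"
      unfolding V' .
    show "scal (z k) (z k) / g (z k) \<le> \<bar>?w\<bar>" "\<bar>?w\<bar> \<le> scal (z k) (z k) / g (z k) + \<bar>wedge (z k) (z (Suc k))\<bar>"
      using q(2,3)[of k] unfolding aw by auto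
  qed (rule p p0 unit glen gpos[OF p(5)] gle[OF p(5)])+
  then have "chain z (\<lambda>k. \<psi> (len (z k)))" by (simp add: g_def)
  moreover have "0 < wedge (z (Suc k)) (z (Suc (Suc k))) \<longleftrightarrow> k \<in> A" for k
    using sw[of k] by (auto simp: s_def split: if_splits)
  ultimately show ?thesis by (rule that)
qed

section \<open>Cardinality and conclusion\<close>

lemma real_vec2_lepoll_real: "(UNIV :: (real ^ 2) set) \<lesssim> (UNIV :: real set)"
proof -
  have "inj (\<lambda>v :: real ^ 2. (v $ 1, v $ 2))" by (auto simp: inj_def vec_eq_iff forall_2)
  then have "(UNIV :: (real ^ 2) set) \<lesssim> (UNIV :: real set) \<times> (UNIV :: real set)"
    unfolding lepoll_def by (metis UNIV_Times_UNIV subset_UNIV)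
  also have "(UNIV :: real set) \<times> (UNIV :: real set) \<approx> (UNIV :: real set)"
    using card_of_Times_same_infinite[of "UNIV :: real set"] infinite_UNIV_char_0
    by (simp add: eqpoll_iff_card_of_ordIso)
  finally show ?thesis .
qed

theorem theorem5:
  fixes \<gamma> :: real and \<psi> :: "real \<Rightarrow> real"
  assumes "\<gamma> = 18 / (9 - sqrt 2)"
    and "\<forall>x>0. \<psi> x > 0"
    and "antimono_on {0<..} \<psi>"
    and "\<psi> 1 \<le> 1 / (9 * \<gamma>)"
  shows "let S = {\<alpha> :: real ^ 2. \<forall>m. best_approximation \<alpha> m \<longrightarrow>
             \<psi> (norm m) - 4 * \<gamma> * (\<psi> (norm m))\<^sup>2 < dist_to_int (\<alpha> \<bullet> m) * (norm m)\<^sup>2 \<and>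
             dist_to_int (\<alpha> \<bullet> m) * (norm m)\<^sup>2 \<le> \<psi> (norm m) + \<gamma> * (\<psi> (norm m))\<^sup>2}
         in (\<exists>\<alpha>. \<alpha> \<in> S) \<and> S \<approx> (UNIV :: real set)"
proof -
  define S where "S = {\<alpha> :: real ^ 2. \<forall>m. best_approximation \<alpha> m \<longrightarrow>
             \<psi> (norm m) - 4 * \<gamma> * (\<psi> (norm m))\<^sup>2 < dist_to_int (\<alpha> \<bullet> m) * (norm m)\<^sup>2 \<and>
             dist_to_int (\<alpha> \<bullet> m) * (norm m)\<^sup>2 \<le> \<psi> (norm m) + \<gamma> * (\<psi> (norm m))\<^sup>2}"
  \<comment> \<open>This bound on the root gives \<open>7/3 \<le> \<gamma>\<close>, hence the
    threshold 1/21 used throughout; \<open>sqrt 2 < 2\<close> keeps the denominator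
    positive.\<close>
  have "9/7 \<le> sqrt 2" by (rule real_le_rsqrt) (simp add: power2_eq_square)
  moreover have "sqrt 2 < 2" using real_sqrt_less_iff[of 2 4] by simp
  ultimately have \<gamma>: "7/3 \<le> \<gamma>" unfolding assms(1) by (simp add: field_simps)
  then have "1 / (9 * \<gamma>) \<le> 1/21" by (simp add: field_simps)
  with assms(4) have \<psi>1: "\<psi> 1 \<le> 1/21" by linarith
  have "\<exists>p z. chain_point z (\<lambda>k. \<psi> (len (z k))) (fst p) (snd p) \<and>
      (\<forall>k. 0 < wedge (z (Suc k)) (z (Suc (Suc k))) \<longleftrightarrow> k \<in> A)" for A
  proof -
    obtain z where z: "chain z (\<lambda>k. \<psi> (len (z k)))"
      "\<And>k. 0 < wedge (z (Suc k)) (z (Suc (Suc k))) \<longleftrightarrow> k \<in> A"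
      using chain_exists[OF assms(2,3) \<psi>1, of A] by metis
    obtain x y where "\<And>k v. \<bar>lin x y v - lin (chain.px z k) (chain.py z k) v\<bar> \<le> 10/9 * (chain.G z k * len v)"
      using chain.limit_point[OF z(1)] by blast
    then have "chain_point z (\<lambda>k. \<psi> (len (z k))) x y"
      using z(1) by (intro chain_point.intro chain_point_axioms.intro)
    then show ?thesis using z(2) by (intro exI[of _ "(x, y)"] exI[of _ z]) simp
  qed
  then obtain p z where pz: "\<And>A. chain_point (z A) (\<lambda>k. \<psi> (len (z A k))) (fst (p A)) (snd (p A))"
    "\<And>A k. 0 < wedge (z A (Suc k)) (z A (Suc (Suc k))) \<longleftrightarrow> k \<in> A"
    by metis
  define a :: "nat set \<Rightarrow> real ^ 2" where "a A = vector [fst (p A), snd (p A)]" for A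
  have "a A \<in> S" for A
  proof -
    interpret chain_point "z A" "\<lambda>k. \<psi> (len (z A k))" "fst (p A)" "snd (p A)" by (rule pz)
    show ?thesis unfolding S_def mem_Collect_eq
    proof (intro allI impI)
      fix m assume "best_approximation (a A) m"
      then obtain k where k: "m = emb (z A k) \<or> m = - emb (z A k)"
        unfolding a_def best_approximation_iff by blast
      define u where "u = \<psi> (norm m)"
      have norm: "norm m = len (z A k)" using k norm_emb[of "z A k"] by auto
      have dist: "dist_to_int (a A \<bullet> m) = \<bar>zeta k\<bar>"
        unfolding a_def using k dist_z[of k] dist_to_int_minus by auto
      have u: "0 < u" using w_pos[of k] by (simp add: u_def norm)
      \<comment> \<open>With \<open>7/3 \<le> \<gamma>\<close>, \<open>4 * \<gamma>\<close> is at
        least 28/3, which makes the lower estimate strict.\<close>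
      have "9 * u\<^sup>2 < 4 * \<gamma> * u\<^sup>2" "2 * u\<^sup>2 \<le> \<gamma> * u\<^sup>2"
        using \<gamma> u by (auto intro!: mult_strict_right_mono mult_right_mono)
      then show "\<psi> (norm m) - 4 * \<gamma> * (\<psi> (norm m))\<^sup>2 < dist_to_int (a A \<bullet> m) * (norm m)\<^sup>2 \<and>
          dist_to_int (a A \<bullet> m) * (norm m)\<^sup>2 \<le> \<psi> (norm m) + \<gamma> * (\<psi> (norm m))\<^sup>2"
        using zeta_N_ge_quadratic[of k] zeta_N_le[of k] unfolding dist u_def norm X_squared by linarith
    qed
  qed
  \<comment> \<open>The point determines the projected chain, hence the signs of its wedges, hence
    the set \<open>A\<close>.\<close>
  moreover have "inj a"
  proof (rule injI)
    fix A B assume "a A = a B"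
    then have "fst (p A) = fst (p B)" "snd (p A) = snd (p B)"
      unfolding a_def by (metis vector_2)+
    then have "chain_point (z B) (\<lambda>k. \<psi> (len (z B k))) (fst (p A)) (snd (p A))"
      using pz(1)[of B] by simp
    then have "emb (z A k) = emb (z B k)" for k
      by (rule chain_point_unique[OF pz(1)])
    then have "wedge (z A k) (z A l) = wedge (z B k) (z B l)" for k l by (intro wedge_emb_cong)
    then have "k \<in> A \<longleftrightarrow> k \<in> B" for k unfolding pz(2)[symmetric] by simp
    then show "A = B" by blast
  qed
  ultimately have "(UNIV :: nat set set) \<lesssim> S" unfolding lepoll_def by blast
  then have "(UNIV :: real set) \<lesssim> S"
    using nat_sets_eqpoll_reals eqpoll_sym lepoll_trans1 by blast
  moreover have "S \<lesssim> (UNIV :: real set)"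
    using subset_imp_lepoll[OF subset_UNIV] real_vec2_lepoll_real by (rule lepoll_trans)
  ultimately have "S \<approx> (UNIV :: real set)" by (simp add: lepoll_antisym)
  then show ?thesis using \<open>\<And>A. a A \<in> S\<close> unfolding S_def[symmetric] Let_def by blast
qed

end
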